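(* Let $F$ be a CNF formula that admits a read-once resolution proof of unsatisfiability, and let $\widehat{\bm A}$ be any matrix obtained by multiplying each entry of $\bm A^F$ by a non-negative scalar (possibly different for each entry) such that every column of $\widehat{\bm A}$ has $\ell^2$ norm at most $1$. Then $\delta(\widehat{\bm A}) < 1 + \sqrt{2}$, where $\delta(\bm B) = \min_i \sum_j |B_{ij}|$ denotes the minimum $\ell^1$ norm of a row of $\bm B$.
   Context: A CNF formula $F$ over Boolean variables $z_1,\dots,z_n$ is a conjunction of clauses $C_1,\dots,C_m$, each a disjunction of literals ($z_j$ or $\neg z_j$). Its clause-variable matrix $\widetilde{\bm A}^F \in \{-1,0,1\}^{m\times n}$ has entry $(i,j)$ equal to $1$ if $z_j$ occurs in $C_i$, $-1$ if $\neg z_j$ occurs in $C_i$, and $0$ otherwise. The matrix $\bm A^F \in \{-1,0,1\}^{m\times(n+1)}$ is obtained by prepending to $\widetilde{\bm A}^F$ a column all of whose entries equal $1$ (this corresponds to the NAE-CNF formula $\bigwedge_i \mathsf{NAE}(z', \text{literals of } C_i)$ with an extra dummy variable $z'$). A tree resolution proof of unsatisfiability of $F$ is a rooted binary tree (every internal vertex has exactly two children) whose vertices are labelled by disjunctive clauses, such that each leaf is labelled by a clause of $F$, the root is labelled by the empty clause, and whenever the two children of an internal vertex are labelled $C = z \vee G$ and $D = \neg z \vee H$ for some variable $z$, the internal vertex is labelled $G \vee H$. It is a read-once resolution proof if every clause of $F$ labels at most one leaf. *)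

theory Defs
  imports "Jordan_Normal_Form.Matrix" "HOL-Analysis.L2_Norm" "HOL-Library.Multiset"
begin

(* Variables are numbered from 0: a formula in n variables uses the variables 0, ..., n - 1. *)

datatype literal = Pos nat | Neg nat

primrec var :: "literal \<Rightarrow> nat" where
  "var (Pos z) = z"
| "var (Neg z) = z"

type_synonym clause = "literal set"

type_synonym cnf = "clause list"

definition cnf_over :: "nat \<Rightarrow> cnf \<Rightarrow> bool" where
  "cnf_over n F \<longleftrightarrow> (\<forall>C\<in>set F. \<forall>l\<in>C. var l < n)"

(* The sign is unambiguous for clauses without complementary literals; for a clause containing
   both literals of a variable we fix the entry to be 1. *)
definition clause_var_mat :: "nat \<Rightarrow> cnf \<Rightarrow> real mat" where
  "clause_var_mat n F = mat (length F) n
     (\<lambda>(i, j). if Pos j \<in> F ! i then 1 else if Neg j \<in> F ! i then - 1 else 0)"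

(* Column 0 belongs to the dummy variable, column j + 1 to the variable j. *)
definition nae_mat :: "nat \<Rightarrow> cnf \<Rightarrow> real mat" where
  "nae_mat n F = mat (length F) (n + 1)
     (\<lambda>(i, j). if j = 0 then 1 else clause_var_mat n F $$ (i, j - 1))"

datatype res_tree = RLeaf clause | RNode clause res_tree res_tree

primrec label :: "res_tree \<Rightarrow> clause" where
  "label (RLeaf C) = C"
| "label (RNode C L R) = C"

primrec leaf_labels :: "res_tree \<Rightarrow> clause multiset" where
  "leaf_labels (RLeaf C) = {#C#}"
| "leaf_labels (RNode C L R) = leaf_labels L + leaf_labels R"

(* As in "C = z \<or> G", the side clauses G and H are not required to omit the resolved literals. *)
definition resolvent :: "clause \<Rightarrow> clause \<Rightarrow> clause \<Rightarrow> bool" where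
  "resolvent C D E \<longleftrightarrow>
     (\<exists>z G H. C = insert (Pos z) G \<and> D = insert (Neg z) H \<and> E = G \<union> H)"

(* The two children of a vertex are unordered. *)
primrec resolution_steps :: "res_tree \<Rightarrow> bool" where
  "resolution_steps (RLeaf C) \<longleftrightarrow> True"
| "resolution_steps (RNode C L R) \<longleftrightarrow>
     (resolvent (label L) (label R) C \<or> resolvent (label R) (label L) C) \<and>
     resolution_steps L \<and> resolution_steps R"

definition tree_resolution_proof :: "cnf \<Rightarrow> res_tree \<Rightarrow> bool" where
  "tree_resolution_proof F T \<longleftrightarrow>
     set_mset (leaf_labels T) \<subseteq> set F \<and> label T = {} \<and> resolution_steps T"

(* Clauses are counted with their multiplicity in F: each of the clauses F ! i may label at most
   one leaf.  If F lists no clause twice, this says that the leaf labels are pairwise distinct. *)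
definition read_once_resolution_proof :: "cnf \<Rightarrow> res_tree \<Rightarrow> bool" where
  "read_once_resolution_proof F T \<longleftrightarrow>
     tree_resolution_proof F T \<and> (\<forall>C\<in>set F. count (leaf_labels T) C \<le> count (mset F) C)"

definition nonneg_entry_scaling :: "real mat \<Rightarrow> real mat \<Rightarrow> bool" where
  "nonneg_entry_scaling A B \<longleftrightarrow>
     (\<exists>s. (\<forall>i<dim_row A. \<forall>j<dim_col A. (0::real) \<le> s i j) \<and>
          B = mat (dim_row A) (dim_col A) (\<lambda>(i, j). s i j * A $$ (i, j)))"

definition min_row_l1_norm :: "real mat \<Rightarrow> real" where
  "min_row_l1_norm B = Min ((\<lambda>i. \<Sum>j<dim_col B. \<bar>B $$ (i, j)\<bar>) ` {..<dim_row B})"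

end

theory Submission
  imports Defs
begin

text \<open>
  Give a leaf at depth $d$ of the resolution tree the weight $2^{-d/2}$, so that the weight vector
  has norm $1$ and its restrictions to the two subtrees of the root have equal norms. A variable
  occurring in a leaf is resolved at some vertex above that leaf, so its column is covered by the
  leaves below such vertices, and Cauchy--Schwarz bounds the weighted sum of the column by the norms
  of the weight vector below them. These norms, summed over all internal vertices, amount exactly to
  $(1 + \sqrt 2)(P - 1)$, where $P$ is the sum of the weights. The dummy column contributes at most
  $1$, and $(1 + \sqrt 2)(P - 1) + 1 < (1 + \sqrt 2) P$.
\<close>

text \<open>Lets leaves be tracked by row indices instead of clauses, so that equal clauses in
  different rows stay apart. Lifting the decomposition along \<open>f\<close> splits
  \<open>mset_set I\<close>, whose multiplicities are at most 1; both parts are therefore sets, and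
  they are disjoint.\<close>

lemma image_mset_mset_set_eq_plusD:
  assumes "finite I" and "image_mset f (mset_set I) = A + B"
  obtains I1 I2 where "I = I1 \<union> I2" "I1 \<inter> I2 = {}"
    "A = image_mset f (mset_set I1)" "B = image_mset f (mset_set I2)"
proof -
  obtain A' B' where AB: "mset_set I = A' + B'" "A = image_mset f A'" "B = image_mset f B'"
    using image_mset_eq_plusD[OF assms(2)] by blast
  have cnt: "count A' x + count B' x = (if x \<in> I then 1 else 0)" for x
    using arg_cong[OF AB(1), of "\<lambda>M. count M x"] assms(1) by (simp add: count_mset_set')
  have le1: "count A' x \<le> 1" "count B' x \<le> 1" for x
    using cnt[of x] by (simp_all split: if_splits)
  have set_of: "M = mset_set (set_mset M)" if "\<And>x. count M x \<le> 1" for M :: "'a multiset"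
  proof (rule multiset_eqI)
    fix x
    show "count M x = count (mset_set (set_mset M)) x"
      using that[of x]
      by (cases "x \<in># M") (simp_all add: count_mset_set' not_in_iff le_antisym flip: count_greater_zero_iff)
  qed
  have A': "A' = mset_set (set_mset A')" and B': "B' = mset_set (set_mset B')"
    using le1 by (intro set_of; simp)+
  have "I = set_mset (mset_set I)"
    using assms(1) by simp
  then have I: "I = set_mset A' \<union> set_mset B'"
    unfolding AB(1) by simp
  have disj: "set_mset A' \<inter> set_mset B' = {}"
  proof (rule ccontr)
    assume "set_mset A' \<inter> set_mset B' \<noteq> {}"
    then obtain x where "x \<in># A'" "x \<in># B'" by auto
    then have "count A' x > 0" "count B' x > 0" by simp_all
    then show False using cnt[of x] by (simp split: if_splits del: count_greater_zero_iff)
  qed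
  show ?thesis
    using that[OF I disj] AB(2,3) A' B' by simp
qed

text \<open>Signs and the order of the children are forgotten here: the weight argument uses only
  that a resolution step loses at most one variable, the same one for both children.\<close>

lemma resolvent_vars:
  assumes "resolvent C D E \<or> resolvent D C E"
  obtains z where "var ` C \<subseteq> insert z (var ` E)" "var ` D \<subseteq> insert z (var ` E)"
  using assms unfolding resolvent_def by fastforce

text \<open>Cauchy--Schwarz against the unit vector \<open>p\<close>. It serves both for the column
  of a resolved variable and for the dummy column.\<close>

lemma sum_weighted_column_le:
  assumes "(\<Sum>i\<in>I. (p i)\<^sup>2) = (1::real)" and "L2_set f I \<le> 1"
    and "\<And>i. i \<in> I \<Longrightarrow> 0 \<le> p i" and "\<And>i. i \<in> I \<Longrightarrow> 0 \<le> f i"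
  shows "(\<Sum>i\<in>I. p i * f i) \<le> 1"
proof -
  have "(\<Sum>i\<in>I. p i * f i) = (\<Sum>i\<in>I. \<bar>p i\<bar> * \<bar>f i\<bar>)"
    using assms(3,4) by (intro sum.cong) auto
  also have "\<dots> \<le> L2_set p I * L2_set f I"
    by (rule L2_set_mult_ineq)
  also have "\<dots> \<le> 1"
    using assms(1,2) by (simp add: L2_set_def)
  finally show ?thesis .
qed

lemma L2_set_subset_le:
  assumes "finite B" and "A \<subseteq> B"
  shows "L2_set f A \<le> L2_set f B"
  unfolding L2_set_def using assms by (intro real_sqrt_le_mono sum_mono2) auto

text \<open>The form needed for induction: only columns of variables absent from the label of the
  current root are counted, which at an empty label means all of \<open>J\<close>. Each subtree gets
  weights of norm 1 of its own, to be rescaled when subtrees are joined.\<close>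

lemma leaf_weights:
  fixes w :: "'i \<Rightarrow> nat \<Rightarrow> real" and cl :: "'i \<Rightarrow> clause"
  assumes J: "finite J" and w0: "\<And>i j. 0 \<le> w i j"
    and occ: "\<And>i j. w i j \<noteq> 0 \<Longrightarrow> j \<in> var ` cl i"
  assumes "finite I" and "\<And>j. L2_set (\<lambda>i. w i j) I \<le> 1"
    and "leaf_labels T = image_mset cl (mset_set I)" and "resolution_steps T"
  shows "\<exists>p. (\<forall>i\<in>I. 0 \<le> p i) \<and> (\<Sum>i\<in>I. (p i)\<^sup>2) = 1 \<and>
    (\<Sum>i\<in>I. p i * (\<Sum>j\<in>J - var ` label T. w i j)) \<le> (1 + sqrt 2) * ((\<Sum>i\<in>I. p i) - 1)"
  using assms(4-)
proof (induction T arbitrary: I)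
  case (RLeaf C)
  have "size (mset_set I) = 1"
    using arg_cong[OF RLeaf.prems(3), of size] by simp
  then obtain i where I: "I = {i}"
    using card_1_singletonE by (metis size_mset_set)
  have "cl i = C"
    using RLeaf.prems(3) I by simp
  \<comment> \<open>The row of a leaf is supported on the variables of its own clause, none of which
    is counted. With the single weight 1 both sides vanish.\<close>
  then have "(\<Sum>j\<in>J - var ` C. w i j) = 0"
    using occ by (intro sum.neutral) auto
  then show ?case
    by (intro exI[of _ "\<lambda>_. 1"]) (simp add: I)
next
  case (RNode C L R)
  obtain I1 I2 where I: "I = I1 \<union> I2" and disj: "I1 \<inter> I2 = {}"
    and lab: "leaf_labels L = image_mset cl (mset_set I1)"
      "leaf_labels R = image_mset cl (mset_set I2)"
    using image_mset_mset_set_eq_plusD[OF RNode.prems(1), of cl "leaf_labels L" "leaf_labels R"]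
      RNode.prems(3) by auto
  have fin: "finite I1" "finite I2"
    using RNode.prems(1) I by auto
  have norm: "L2_set (\<lambda>i. w i j) I1 \<le> 1" "L2_set (\<lambda>i. w i j) I2 \<le> 1" for j
    using L2_set_subset_le[of I _ "\<lambda>i. w i j"] RNode.prems(1) RNode.prems(2)[of j] I
    by (meson order_trans sup_ge1 sup_ge2)+
  obtain p1 where p1: "\<And>i. i \<in> I1 \<Longrightarrow> 0 \<le> p1 i" "(\<Sum>i\<in>I1. (p1 i)\<^sup>2) = 1"
    "(\<Sum>i\<in>I1. p1 i * (\<Sum>j\<in>J - var ` label L. w i j)) \<le> (1 + sqrt 2) * ((\<Sum>i\<in>I1. p1 i) - 1)"
    using RNode.IH(1)[OF fin(1) norm(1) lab(1)] RNode.prems(4) by auto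
  obtain p2 where p2: "\<And>i. i \<in> I2 \<Longrightarrow> 0 \<le> p2 i" "(\<Sum>i\<in>I2. (p2 i)\<^sup>2) = 1"
    "(\<Sum>i\<in>I2. p2 i * (\<Sum>j\<in>J - var ` label R. w i j)) \<le> (1 + sqrt 2) * ((\<Sum>i\<in>I2. p2 i) - 1)"
    using RNode.IH(2)[OF fin(2) norm(2) lab(2)] RNode.prems(4) by auto
  obtain z where z: "var ` label L \<subseteq> insert z (var ` C)" "var ` label R \<subseteq> insert z (var ` C)"
    using resolvent_vars RNode.prems(4) by (metis resolution_steps.simps(2))
  \<comment> \<open>Two unit vectors with disjoint supports together have norm
    \<open>sqrt 2\<close>; the division restores norm 1.\<close>
  define p where "p i = (if i \<in> I1 then p1 i else p2 i) / sqrt 2" for i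
  have split: "(\<Sum>i\<in>I. g i (p i)) = (\<Sum>i\<in>I1. g i (p1 i / sqrt 2)) + (\<Sum>i\<in>I2. g i (p2 i / sqrt 2))"
    for g :: "'i \<Rightarrow> real \<Rightarrow> real"
  proof -
    have "(\<Sum>i\<in>I1. g i (p i)) = (\<Sum>i\<in>I1. g i (p1 i / sqrt 2))"
      by (intro sum.cong) (auto simp: p_def)
    moreover have "(\<Sum>i\<in>I2. g i (p i)) = (\<Sum>i\<in>I2. g i (p2 i / sqrt 2))"
      using disj by (intro sum.cong) (auto simp: p_def)
    ultimately show ?thesis
      unfolding I by (simp add: sum.union_disjoint[OF fin disj])
  qed
  have p0: "0 \<le> p i" if "i \<in> I" for i
    using that p1(1) p2(1) by (auto simp: p_def I)
  have pn: "(\<Sum>i\<in>I. (p i)\<^sup>2) = 1"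
    using split[of "\<lambda>_ x. x\<^sup>2"] p1(2) p2(2)
    by (simp add: power_divide flip: sum_divide_distrib)
  have psum: "(\<Sum>i\<in>I. p i) = ((\<Sum>i\<in>I1. p1 i) + (\<Sum>i\<in>I2. p2 i)) / sqrt 2"
    using split[of "\<lambda>_ x. x"] by (simp add: add_divide_distrib flip: sum_divide_distrib)
  define D where "D i = (if i \<in> I1 then label L else label R)" for i
  \<comment> \<open>Passing from a child to its parent, only column \<open>z\<close> can become
    newly counted. If \<open>z\<close> was counted already or lies outside \<open>J\<close>, the
    extra term is harmless because \<open>w\<close> is nonnegative.\<close>
  have row: "(\<Sum>j\<in>J - var ` C. w i j) \<le> w i z + (\<Sum>j\<in>J - var ` D i. w i j)" for i
  proof -
    have "(\<Sum>j\<in>J - var ` C. w i j) \<le> (\<Sum>j\<in>insert z (J - var ` D i). w i j)"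
      using J z w0 by (intro sum_mono2) (auto simp: D_def)
    also have "\<dots> \<le> w i z + (\<Sum>j\<in>J - var ` D i. w i j)"
      using J w0[of i z] by (simp add: sum.insert_if)
    finally show ?thesis .
  qed
  have "(\<Sum>i\<in>I. p i * (\<Sum>j\<in>J - var ` C. w i j))
      \<le> (\<Sum>i\<in>I. p i * (w i z + (\<Sum>j\<in>J - var ` D i. w i j)))"
    by (intro sum_mono mult_left_mono row p0)
  also have "\<dots> = (\<Sum>i\<in>I. p i * w i z) + (\<Sum>i\<in>I. p i * (\<Sum>j\<in>J - var ` D i. w i j))"
    by (simp add: distrib_left sum.distrib)
  also have "(\<Sum>i\<in>I. p i * w i z) \<le> 1"
    using pn RNode.prems(2) p0 w0 by (intro sum_weighted_column_le)
  also have "(\<Sum>i\<in>I. p i * (\<Sum>j\<in>J - var ` D i. w i j)) =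
      ((\<Sum>i\<in>I1. p1 i * (\<Sum>j\<in>J - var ` label L. w i j))
      + (\<Sum>i\<in>I2. p2 i * (\<Sum>j\<in>J - var ` label R. w i j))) / sqrt 2"
  proof -
    have "(\<Sum>i\<in>I1. p1 i * (\<Sum>j\<in>J - var ` D i. w i j)) = (\<Sum>i\<in>I1. p1 i * (\<Sum>j\<in>J - var ` label L. w i j))"
      by (intro sum.cong) (auto simp: D_def)
    moreover have "(\<Sum>i\<in>I2. p2 i * (\<Sum>j\<in>J - var ` D i. w i j)) = (\<Sum>i\<in>I2. p2 i * (\<Sum>j\<in>J - var ` label R. w i j))"
      using disj by (intro sum.cong) (auto simp: D_def)
    ultimately show ?thesis
      using split[of "\<lambda>i x. x * (\<Sum>j\<in>J - var ` D i. w i j)"]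
      by (simp add: add_divide_distrib flip: sum_divide_distrib)
  qed
  also have "\<dots> \<le> ((1 + sqrt 2) * ((\<Sum>i\<in>I1. p1 i) - 1) + (1 + sqrt 2) * ((\<Sum>i\<in>I2. p2 i) - 1)) / sqrt 2"
    by (intro divide_right_mono add_mono p1(3) p2(3)) auto
  \<comment> \<open>This fixes the constant: with P the sum of the new weights, 1 + c (P - sqrt 2) =
    c (P - 1) holds exactly when c (sqrt 2 - 1) = 1, that is, c = 1 + sqrt 2.\<close>
  also have "1 + \<dots> = (1 + sqrt 2) * ((\<Sum>i\<in>I. p i) - 1)"
    unfolding psum by (simp add: field_simps)
  finally show ?case
    using p0 pn by (intro exI[of _ p]) auto
qed

theorem theorem2:
  fixes n :: nat and F :: cnf and Ahat :: "real mat"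
  assumes "cnf_over n F"
    and "\<exists>T. read_once_resolution_proof F T"
    and "nonneg_entry_scaling (nae_mat n F) Ahat"
    and "\<And>j. j < dim_col Ahat \<Longrightarrow> L2_set (\<lambda>i. Ahat $$ (i, j)) {..<dim_row Ahat} \<le> 1"
  shows "min_row_l1_norm Ahat < 1 + sqrt 2"
proof -
  obtain T where T: "set_mset (leaf_labels T) \<subseteq> set F" "label T = {}" "resolution_steps T"
    "\<forall>C\<in>set F. count (leaf_labels T) C \<le> count (mset F) C"
    using assms(2) unfolding read_once_resolution_proof_def tree_resolution_proof_def by blast
  obtain s where s: "\<And>i j. i < length F \<Longrightarrow> j < n + 1 \<Longrightarrow> 0 \<le> s i j"
    and A: "Ahat = mat (length F) (n + 1) (\<lambda>(i, j). s i j * nae_mat n F $$ (i, j))"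
    using assms(3) unfolding nonneg_entry_scaling_def by (auto simp: nae_mat_def)
  have dims: "dim_row Ahat = length F" "dim_col Ahat = Suc n"
    by (simp_all add: A)
  \<comment> \<open>Here the read-once condition enters: it allows the leaves to be assigned to
    pairwise distinct rows, collected in \<open>I\<close>.\<close>
  have "leaf_labels T \<subseteq># mset F"
    using T(1,4) by (intro mset_subset_eqI) (metis count_inI subset_iff le0)
  then obtain M where "mset F = leaf_labels T + M"
    using subset_mset.le_iff_add by blast
  moreover have "mset F = image_mset ((!) F) (mset_set {..<length F})"
    by (metis map_nth mset_map mset_upt atLeast0LessThan)
  ultimately obtain I I' where I: "{..<length F} = I \<union> I'"
    and lab: "leaf_labels T = image_mset ((!) F) (mset_set I)"
    using image_mset_mset_set_eq_plusD[of "{..<length F}" "(!) F" "leaf_labels T" M] by (metis finite_lessThan)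
  have subI: "I \<subseteq> {..<length F}" and finI: "finite I"
    using I by (auto intro: finite_subset[of _ "{..<length F}"])
  \<comment> \<open>\<open>Suc j\<close> skips the dummy column, which is bounded separately. The
    value 0 outside the matrix makes the support and column bounds hold for all indices.\<close>
  define w where "w i j = (if i < length F \<and> j < n then \<bar>Ahat $$ (i, Suc j)\<bar> else 0)" for i j
  have col: "L2_set (\<lambda>i. \<bar>Ahat $$ (i, j)\<bar>) I \<le> 1" if "j < Suc n" for j
    using L2_set_subset_le[OF _ subI, of "\<lambda>i. \<bar>Ahat $$ (i, j)\<bar>"] assms(4)[of j] that
    by (simp add: dims L2_set_def)
  have wcol: "L2_set (\<lambda>i. w i j) I \<le> 1" for j
  proof (cases "j < n")
    case True
    then have "L2_set (\<lambda>i. w i j) I = L2_set (\<lambda>i. \<bar>Ahat $$ (i, Suc j)\<bar>) I"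
      using subI by (intro L2_set_cong) (auto simp: w_def)
    then show ?thesis using col[of "Suc j"] True by simp
  qed (simp add: w_def L2_set_def)
  have w0: "0 \<le> w i j" for i j
    by (simp add: w_def)
  \<comment> \<open>Scaling entry by entry cannot create a nonzero entry where the matrix of the
    formula has a zero.\<close>
  have occ: "j \<in> var ` (F ! i)" if "w i j \<noteq> 0" for i j
    using that by (force simp: w_def A nae_mat_def clause_var_mat_def split: if_splits)
  obtain p where p: "\<And>i. i \<in> I \<Longrightarrow> 0 \<le> p i" "(\<Sum>i\<in>I. (p i)\<^sup>2) = 1"
    "(\<Sum>i\<in>I. p i * (\<Sum>j<n. w i j)) \<le> (1 + sqrt 2) * ((\<Sum>i\<in>I. p i) - 1)"
    using leaf_weights[where J = "{..<n}" and w = w, OF finite_lessThan w0 occ finI wcol lab T(3)] T(2)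
    by auto
  have dummy: "(\<Sum>i\<in>I. p i * \<bar>Ahat $$ (i, 0)\<bar>) \<le> 1"
    using p(1,2) col[of 0] by (intro sum_weighted_column_le) auto
  have row: "(\<Sum>j<dim_col Ahat. \<bar>Ahat $$ (i, j)\<bar>) = \<bar>Ahat $$ (i, 0)\<bar> + (\<Sum>j<n. w i j)" if "i \<in> I" for i
    unfolding dims sum.lessThan_Suc_shift using that subI by (auto simp: w_def)
  have "\<exists>i\<in>I. (\<Sum>j<dim_col Ahat. \<bar>Ahat $$ (i, j)\<bar>) < 1 + sqrt 2"
  proof (rule ccontr)
    assume "\<not> ?thesis"
    then have "(\<Sum>i\<in>I. p i * (1 + sqrt 2)) \<le> (\<Sum>i\<in>I. p i * (\<bar>Ahat $$ (i, 0)\<bar> + (\<Sum>j<n. w i j)))"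
      using p(1) row by (intro sum_mono mult_left_mono) (auto simp: not_less)
    also have "\<dots> = (\<Sum>i\<in>I. p i * \<bar>Ahat $$ (i, 0)\<bar>) + (\<Sum>i\<in>I. p i * (\<Sum>j<n. w i j))"
      by (simp add: distrib_left sum.distrib)
    also have "\<dots> \<le> 1 + (1 + sqrt 2) * ((\<Sum>i\<in>I. p i) - 1)"
      using dummy p(3) by simp
    \<comment> \<open>The dummy column costs 1 while the root saves 1 + sqrt 2; the difference sqrt
      2 gives the strict inequality, even if some weights are 0.\<close>
    also have "\<dots> = (\<Sum>i\<in>I. p i * (1 + sqrt 2)) - sqrt 2"
      unfolding sum_distrib_right[symmetric] by (simp add: algebra_simps)
    finally show False by simp
  qed
  then obtain i where i: "i \<in> I" "(\<Sum>j<dim_col Ahat. \<bar>Ahat $$ (i, j)\<bar>) < 1 + sqrt 2"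
    by blast
  have "min_row_l1_norm Ahat \<le> (\<Sum>j<dim_col Ahat. \<bar>Ahat $$ (i, j)\<bar>)"
    unfolding min_row_l1_norm_def using i(1) subI by (intro Min_le) (auto simp: dims)
  then show ?thesis
    using i(2) by simp
qed

end
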